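(* Let $\varphi:\mathbb{R}\to[0,1]$ be defined by $\varphi(s)=0$ if $s<0$, $\varphi(s)=s$ if $s\in[0,1]$, $\varphi(s)=1$ if $s>1$. Let $$A_0=\begin{pmatrix}-0.1 & 0.5\\ -2 & 0\end{pmatrix},\qquad A_1=\begin{pmatrix}0 & 2\\ -0.5 & -0.1\end{pmatrix},$$ and $g(x,u)=(1+|x|^2)\big(\varphi(u)A_1+(1-\varphi(u))A_0\big)x$ for $x\in\mathbb{R}^2$, $u\in\mathbb{R}$. For $c>0$ consider the time-delay system $$\dot x(t)=c\,\varphi(z_2(t-2))\,g\big(x(t),z_1(t-1)\big)+c\big(1-\varphi(z_2(t-2))\big)A_0x(t),\qquad \dot z_1(t)=-z_1(t),\qquad \dot z_2(t)=-z_2(t),$$ with $x(t)\in\mathbb{R}^2$, $z_1(t),z_2(t)\in\mathbb{R}$ and initial data $x_0\in C([-2,0],\mathbb{R})^2$, $z_{10},z_{20}\in C([-2,0],\mathbb{R})$ prescribed on $[-2,0]$. Then there exists a constant $c>0$ such that, for every $M>0$, there exist $z_{10}\in C([-2,0],\mathbb{R})$ with $\|z_{10}\|\le1$ and $z_{10}(0)=0$, and $x_0\in C([-2,0],\mathbb{R})^2$ with $\|x_0\|\le1$, such that for every $z_{20}\in C([-2,0],\mathbb{R})$ satisfying $z_{20}(t)=1$ for all $t\in[-2,-1]$, the corresponding solution satisfies $|x(1)|\ge 2M$.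
   Context: $|\cdot|$ denotes the Euclidean norm and, for a continuous function $\psi$ on $[-2,0]$, $\|\psi\|=\sup_{\tau\in[-2,0]}|\psi(\tau)|$. *)

theory Defs
  imports "HOL-Analysis.Analysis"
begin

definition sat :: "real \<Rightarrow> real" where
  "sat s = (if s < 0 then 0 else if s \<le> 1 then s else 1)"

definition A0 :: "real^2^2" where
  "A0 = vector [vector [-1/10, 1/2], vector [-2, 0]]"

definition A1 :: "real^2^2" where
  "A1 = vector [vector [0, 2], vector [-1/2, -1/10]]"

definition g :: "real^2 \<Rightarrow> real \<Rightarrow> real^2" where
  "g x u = (1 + (norm x)^2) *\<^sub>R ((sat u *\<^sub>R A1 + (1 - sat u) *\<^sub>R A0) *v x)"

text \<open>(x, z1, z2) is a solution on [-2,1] of the delay system with parameter c and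
  initial data x0, z10, z20 on [-2,0]; derivatives on [0,1] are taken within [0,1]
  (one-sided at the endpoints).\<close>
definition is_solution ::
  "real \<Rightarrow> (real \<Rightarrow> real^2) \<Rightarrow> (real \<Rightarrow> real) \<Rightarrow> (real \<Rightarrow> real)
   \<Rightarrow> (real \<Rightarrow> real^2) \<Rightarrow> (real \<Rightarrow> real) \<Rightarrow> (real \<Rightarrow> real) \<Rightarrow> bool" where
  "is_solution c x0 z10 z20 x z1 z2 \<longleftrightarrow>
     continuous_on {-2..1} x \<and> continuous_on {-2..1} z1 \<and> continuous_on {-2..1} z2 \<and>
     (\<forall>t\<in>{-2..0}. x t = x0 t \<and> z1 t = z10 t \<and> z2 t = z20 t) \<and>
     (\<forall>t\<in>{0..1}.
        (x has_vector_derivative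
           ((c * sat (z2 (t - 2))) *\<^sub>R g (x t) (z1 (t - 1))
            + (c * (1 - sat (z2 (t - 2)))) *\<^sub>R (A0 *v x t))) (at t within {0..1}) \<and>
        (z1 has_vector_derivative (- z1 t)) (at t within {0..1}) \<and>
        (z2 has_vector_derivative (- z2 t)) (at t within {0..1}))"

end

theory Submission
  imports Defs
begin

(* Once z20 = 1 on [-2,-1], the x-equation on [0,1] is the open-loop system x' = c g(x, u(t))
   with control u(t) = z10(t - 1); it is locally Lipschitz, so its solutions are unique.
   Write x = e^rho (cos p, - sin p).  Both A0 and A1 are stable, but choosing the control by the
   feedback u = switch_law p turns d rho / dp into a pi/2-periodic function of positive mean, so
   along the resulting spiral rho grows linearly with the angle p.  The factor 1 + |x|^2 makes
   the angular speed grow like e^(2 rho), so the spiral winds infinitely often in finite time.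
   For c large, following it backwards for time 1 from a point of radius at least 2M at which
   switch_law vanishes ends inside the unit disc; the control along that arc is z10. *)

section \<open>Real-analysis preliminaries\<close>

lemma quadratic_form_nonneg:
  fixes x y :: real
  assumes "0 < a" "b\<^sup>2 \<le> 4 * a * c"
  shows "0 \<le> a * x\<^sup>2 + b * x * y + c * y\<^sup>2"
proof -
  have "4 * a * (a * x\<^sup>2 + b * x * y + c * y\<^sup>2) = (2 * a * x + b * y)\<^sup>2 + (4 * a * c - b\<^sup>2) * y\<^sup>2"
    by (simp add: algebra_simps power2_eq_square)
  also have "\<dots> \<ge> 0"
    using assms by simp
  finally show ?thesis
    using assms by (simp add: zero_le_mult_iff)
qed

lemma convex_bound_ge:
  fixes x y a u v :: real
  assumes "a \<le> x" "a \<le> y" "0 \<le> u" "0 \<le> v" "u + v = 1"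
  shows "a \<le> u * x + v * y"
  using convex_bound_le[of "-x" "-a" "-y" u v] assms by simp

lemma sin_ge_half_self:
  assumes "0 \<le> x" "x \<le> pi/3"
  shows "x/2 \<le> sin x"
proof -
  have "(\<lambda>x. sin x - x/2) 0 \<le> (\<lambda>x. sin x - x/2) x"
  proof (rule DERIV_nonneg_imp_nondecreasing[OF assms(1)])
    fix y assume y: "0 \<le> y" "y \<le> x"
    have "cos (pi/3) \<le> cos y"
      using y assms by (intro cos_monotone_0_pi_le) auto
    then have "0 \<le> cos y - 1/2"
      by (simp add: cos_60)
    moreover have "((\<lambda>x. sin x - x/2) has_real_derivative cos y - 1/2) (at y)"
      by (auto intro!: derivative_eq_intros)
    ultimately show "\<exists>d. ((\<lambda>x. sin x - x/2) has_real_derivative d) (at y) \<and> 0 \<le> d"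
      by blast
  qed
  then show ?thesis
    by simp
qed

lemma DERIV_ge_imp_increment_ge:
  fixes f f' :: "real \<Rightarrow> real"
  assumes "a \<le> b"
    and deriv: "\<And>x. a \<le> x \<Longrightarrow> x \<le> b \<Longrightarrow> (f has_real_derivative f' x) (at x)"
    and bound: "\<And>x. a \<le> x \<Longrightarrow> x \<le> b \<Longrightarrow> m \<le> f' x"
  shows "m * (b - a) \<le> f b - f a"
proof -
  have "(\<lambda>x. f x - m * x) a \<le> (\<lambda>x. f x - m * x) b"
  proof (rule DERIV_nonneg_imp_nondecreasing[OF \<open>a \<le> b\<close>])
    fix x assume x: "a \<le> x" "x \<le> b"
    have "((\<lambda>x. f x - m * x) has_real_derivative f' x - m) (at x)"
      using deriv[OF x] by (auto intro!: derivative_eq_intros)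
    then show "\<exists>y. ((\<lambda>x. f x - m * x) has_real_derivative y) (at x) \<and> 0 \<le> y"
      using bound[OF x] by force
  qed
  then show ?thesis
    by (simp add: algebra_simps)
qed

lemma DERIV_le_exp_decay_imp_increment_le:
  fixes f f' :: "real \<Rightarrow> real"
  assumes "0 < \<alpha>" "0 \<le> B" "a \<le> b"
    and deriv: "\<And>x. a \<le> x \<Longrightarrow> x \<le> b \<Longrightarrow> (f has_real_derivative f' x) (at x)"
    and bound: "\<And>x. a \<le> x \<Longrightarrow> x \<le> b \<Longrightarrow> f' x \<le> B * exp (- \<alpha> * (x - a))"
  shows "f b - f a \<le> B / \<alpha>"
proof -
  define E where "E x = B / \<alpha> * exp (- \<alpha> * (x - a))" for x
  have "0 * (b - a) \<le> (\<lambda>x. - f x - E x) b - (\<lambda>x. - f x - E x) a"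
  proof (rule DERIV_ge_imp_increment_ge[OF \<open>a \<le> b\<close>])
    fix x assume x: "a \<le> x" "x \<le> b"
    show "((\<lambda>x. - f x - E x) has_real_derivative B * exp (- \<alpha> * (x - a)) - f' x) (at x)"
      unfolding E_def using deriv[OF x] \<open>0 < \<alpha>\<close> by (auto intro!: derivative_eq_intros)
    show "0 \<le> B * exp (- \<alpha> * (x - a)) - f' x"
      using bound[OF x] by simp
  qed
  then have "f b - f a \<le> E a - E b"
    by simp
  also have "\<dots> \<le> B / \<alpha>"
    using assms by (simp add: E_def)
  finally show ?thesis .
qed

lemma periodic_derivative_increment:
  fixes F f :: "real \<Rightarrow> real"
  assumes deriv: "\<And>x. 0 \<le> x \<Longrightarrow> (F has_real_derivative f x) (at x)"
    and periodic: "\<And>x. 0 \<le> x \<Longrightarrow> f (x + T) = f x"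
    and "0 \<le> T" "0 \<le> x"
  shows "F (x + T) - F x = F T - F 0"
proof (cases "x = 0")
  case False
  let ?D = "\<lambda>x. F (x + T) - F x"
  have "((\<lambda>x. F (x + T)) has_real_derivative f (x + T)) (at x)" if "0 \<le> x" for x
    using deriv[of "x + T"] that \<open>0 \<le> T\<close> DERIV_shift[of F] by simp
  then have D_deriv: "(?D has_real_derivative 0) (at x)" if "0 \<le> x" for x
    using that deriv[OF that] periodic[OF that] by (auto intro!: derivative_eq_intros)
  have "continuous_on {0..x} ?D"
    by (rule continuous_at_imp_continuous_on) (metis atLeastAtMost_iff D_deriv DERIV_isCont)
  then have "?D x = ?D 0"
    using \<open>0 \<le> x\<close> False by (intro DERIV_isconst_end D_deriv) auto
  then show ?thesis
    by simp
qed simp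

lemma periodic_derivative_linear_growth:
  fixes F f :: "real \<Rightarrow> real"
  assumes deriv: "\<And>x. 0 \<le> x \<Longrightarrow> (F has_real_derivative f x) (at x)"
    and periodic: "\<And>x. 0 \<le> x \<Longrightarrow> f (x + T) = f x"
    and "0 < T"
  obtains K where "\<And>x. 0 \<le> x \<Longrightarrow> \<bar>F x - F 0 - (F T - F 0) / T * x\<bar> \<le> K"
proof -
  define \<gamma> where "\<gamma> = (F T - F 0) / T"
  define P where "P x = F x - F 0 - \<gamma> * x" for x
  have P_shift: "P (x + real n * T) = P x" if "0 \<le> x" for x n
  proof (induction n)
    case (Suc n)
    have "F (x + real n * T + T) - F (x + real n * T) = \<gamma> * T"
      using \<open>0 < T\<close> that unfolding \<gamma>_def
      by (simp add: periodic_derivative_increment[OF deriv periodic])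
    then have "P (x + real n * T + T) = P (x + real n * T)"
      by (simp add: P_def algebra_simps)
    then show ?case
      using Suc by (simp add: algebra_simps)
  qed simp
  have "continuous_on {0..T} P"
    unfolding P_def by (intro continuous_intros continuous_at_imp_continuous_on)
      (metis atLeastAtMost_iff deriv DERIV_isCont)
  then obtain K where K: "\<And>x. x \<in> {0..T} \<Longrightarrow> \<bar>P x\<bar> \<le> K"
    using continuous_on_compact_bound[of "{0..T}" P] by auto
  have "\<bar>P x\<bar> \<le> K" if "0 \<le> x" for x
  proof -
    define n where "n = nat \<lfloor>x / T\<rfloor>"
    have n: "real n = of_int \<lfloor>x / T\<rfloor>"
      using that \<open>0 < T\<close> by (simp add: n_def)
    have "x - real n * T \<in> {0..T}"
      using floor_divide_lower[OF \<open>0 < T\<close>, of x] floor_divide_upper[OF \<open>0 < T\<close>, of x]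
      unfolding n by (auto simp: algebra_simps)
    moreover have "P x = P (x - real n * T)"
      using P_shift[of "x - real n * T" n] calculation by simp
    ultimately show ?thesis
      using K by simp
  qed
  then show ?thesis
    using that unfolding P_def \<gamma>_def by blast
qed

lemma inv_into_of_DERIV_pos:
  fixes \<Phi> w :: "real \<Rightarrow> real"
  assumes deriv: "\<And>p. 0 < p \<Longrightarrow> (\<Phi> has_real_derivative w p) (at p)"
    and pos: "\<And>p. 0 < p \<Longrightarrow> 0 < w p"
    and "0 < x"
  shows "inv_into {0<..} \<Phi> (\<Phi> x) = x"
    and "(inv_into {0<..} \<Phi> has_real_derivative inverse (w x)) (at (\<Phi> x))"
proof -
  have "\<Phi> x < \<Phi> y" if "0 < x" "x < y" for x y
  proof (rule DERIV_pos_imp_increasing[OF that(2)])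
    fix z assume "x \<le> z" "z \<le> y"
    then have "0 < z"
      using that by linarith
    then show "\<exists>d. (\<Phi> has_real_derivative d) (at z) \<and> 0 < d"
      using deriv pos by blast
  qed
  then have "inj_on \<Phi> {0<..}"
    by (auto intro: strict_mono_onI strict_mono_on_imp_inj_on)
  then have inverse: "inv_into {0<..} \<Phi> (\<Phi> y) = y" if "0 < y" for y
    using that by simp
  then show "inv_into {0<..} \<Phi> (\<Phi> x) = x"
    using \<open>0 < x\<close> .
  have "(inv_into {0<..} \<Phi> has_derivative (\<lambda>h. inverse (w x) * h)) (at (\<Phi> x))"
  proof (rule has_derivative_inverse_on[of "{0<..}" \<Phi> "\<lambda>x h. w x * h"])
    show "(\<Phi> has_derivative (\<lambda>h. w y * h)) (at y)" if "y \<in> {0<..}" for y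
      using deriv[of y] that by (simp add: has_field_derivative_def)
    show "(\<lambda>h. w x * h) \<circ> (\<lambda>h. inverse (w x) * h) = id"
      using pos[OF \<open>0 < x\<close>] by (auto simp: fun_eq_iff)
  qed (use \<open>0 < x\<close> inverse in auto)
  then show "(inv_into {0<..} \<Phi> has_real_derivative inverse (w x)) (at (\<Phi> x))"
    by (simp add: has_field_derivative_def)
qed

lemma inverse_reparametrization:
  fixes \<Phi> w :: "real \<Rightarrow> real"
  assumes deriv: "\<And>p. 0 < p \<Longrightarrow> (\<Phi> has_real_derivative w p) (at p)"
    and pos: "\<And>p. 0 < p \<Longrightarrow> 0 < w p"
    and "0 < a" "a \<le> b"
  obtains \<theta> where "\<theta> 0 = a" "\<theta> (\<Phi> b - \<Phi> a) = b"
    "\<And>t. 0 \<le> t \<Longrightarrow> t \<le> \<Phi> b - \<Phi> a \<Longrightarrow>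
      a \<le> \<theta> t \<and> (\<theta> has_real_derivative inverse (w (\<theta> t))) (at t)"
proof -
  define \<theta> where "\<theta> t = inv_into {0<..} \<Phi> (t + \<Phi> a)" for t
  note inverse = inv_into_of_DERIV_pos[OF deriv pos]
  have "continuous_on {a..b} \<Phi>"
    using assms by (intro continuous_at_imp_continuous_on ballI DERIV_isCont[OF deriv]) auto
  have "a \<le> \<theta> t \<and> (\<theta> has_real_derivative inverse (w (\<theta> t))) (at t)"
    if t: "0 \<le> t" "t \<le> \<Phi> b - \<Phi> a" for t
  proof -
    obtain x where x: "a \<le> x" "x \<le> b" "\<Phi> x = t + \<Phi> a"
      using t assms IVT'[of \<Phi> a "t + \<Phi> a" b] \<open>continuous_on {a..b} \<Phi>\<close> by auto
    then have "\<theta> t = x"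
      using assms inverse(1) by (simp add: \<theta>_def flip: x(3))
    moreover have "(inv_into {0<..} \<Phi> has_real_derivative inverse (w x)) (at (t + \<Phi> a))"
      using inverse(2)[of x] x assms by simp
    ultimately show ?thesis
      using x(1) by (simp add: \<theta>_def[abs_def] DERIV_shift)
  qed
  moreover have "\<theta> 0 = a" "\<theta> (\<Phi> b - \<Phi> a) = b"
    using assms inverse(1) by (simp_all add: \<theta>_def)
  ultimately show thesis
    using that by blast
qed

lemma lipschitz_ode_unique:
  fixes x y :: "real \<Rightarrow> 'a::real_inner"
  assumes "a \<le> b"
    and dx: "\<And>t. t \<in> {a..b} \<Longrightarrow> (x has_vector_derivative f t (x t)) (at t within {a..b})"
    and dy: "\<And>t. t \<in> {a..b} \<Longrightarrow> (y has_vector_derivative f t (y t)) (at t within {a..b})"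
    and lipschitz: "\<And>t. t \<in> {a..b} \<Longrightarrow> norm (f t (x t) - f t (y t)) \<le> L * norm (x t - y t)"
    and "x a = y a"
  shows "x b = y b"
proof -
  define d where "d t = x t - y t" for t
  define D where "D t = f t (x t) - f t (y t)" for t
  \<comment> \<open>Gronwall: \<open>|x - y|\<^sup>2 e\<^bsup>-2Lt\<^esup>\<close> is nonincreasing and vanishes at \<open>a\<close>.\<close>
  define e where "e t = (d t \<bullet> d t) * exp (- 2 * L * t)" for t
  define e' where "e' t = (2 * (d t \<bullet> D t) - 2 * L * (d t \<bullet> d t)) * exp (- 2 * L * t)" for t
  have e_deriv: "(e has_real_derivative e' t) (at t within {a..b})" if "t \<in> {a..b}" for t
  proof -
    have "(d has_derivative (\<lambda>h. h *\<^sub>R D t)) (at t within {a..b})"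
      using dx[OF that] dy[OF that] unfolding d_def[abs_def] D_def has_vector_derivative_def
      by (auto intro!: derivative_eq_intros simp: algebra_simps)
    from has_derivative_inner[OF this this]
    have "((\<lambda>t. d t \<bullet> d t) has_real_derivative 2 * (d t \<bullet> D t)) (at t within {a..b})"
      unfolding has_field_derivative_def
      by (rule has_derivative_eq_rhs) (auto simp: fun_eq_iff inner_commute algebra_simps)
    then show ?thesis
      unfolding e_def[abs_def] e'_def by (auto intro!: derivative_eq_intros simp: algebra_simps)
  qed
  obtain \<xi> where "\<xi> \<in> {a..b}" "e b - e a = e' \<xi> * (b - a)"
    using mvt_very_simple[of a b e "\<lambda>t. (*) (e' t)"] e_deriv \<open>a \<le> b\<close>
    by (auto simp: has_field_derivative_def)
  moreover have "e' t \<le> 0" if "t \<in> {a..b}" for t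
  proof -
    have "d t \<bullet> D t \<le> norm (d t) * norm (D t)"
      by (rule Cauchy_Schwarz_ineq2[THEN order_trans[OF abs_ge_self]])
    also have "\<dots> \<le> norm (d t) * (L * norm (d t))"
      using lipschitz[OF that] by (intro mult_left_mono) (auto simp: d_def D_def)
    also have "\<dots> = L * (d t \<bullet> d t)"
      by (simp add: power2_norm_eq_inner[symmetric] power2_eq_square)
    finally show ?thesis
      unfolding e'_def by (simp add: mult_nonpos_nonneg)
  qed
  moreover have "e a = 0"
    by (simp add: e_def d_def \<open>x a = y a\<close>)
  ultimately have "e b \<le> 0"
    using \<open>a \<le> b\<close> by (auto intro: mult_nonpos_nonneg)
  then have "d b \<bullet> d b \<le> 0"
    by (simp add: e_def mult_le_0_iff)
  then have "d b \<bullet> d b = 0"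
    using inner_ge_zero[of "d b"] by linarith
  then show ?thesis
    by (simp add: d_def)
qed

section \<open>The switched system in polar coordinates\<close>

lemma sat_bounds: "0 \<le> sat s" "sat s \<le> 1"
  by (auto simp: sat_def)

lemma sat_eq_self: "0 \<le> s \<Longrightarrow> s \<le> 1 \<Longrightarrow> sat s = s"
  by (auto simp: sat_def)

lemma sat_one_minus: "sat (1 - s) = 1 - sat s"
  by (auto simp: sat_def)

lemma continuous_on_sat [continuous_intros]:
  assumes "continuous_on S f"
  shows "continuous_on S (\<lambda>x. sat (f x))"
proof -
  have "(\<lambda>x. sat (f x)) = (\<lambda>x. max 0 (min 1 (f x)))"
    by (auto simp: sat_def fun_eq_iff)
  then show ?thesis
    by (simp only:) (intro continuous_intros assms)
qed

definition switched_matrix :: "real \<Rightarrow> real^2^2" where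
  "switched_matrix l = l *\<^sub>R A1 + (1 - l) *\<^sub>R A0"

lemma g_switched_matrix: "g x u = (1 + (norm x)\<^sup>2) *\<^sub>R (switched_matrix (sat u) *v x)"
  by (simp add: g_def switched_matrix_def)

lemma switched_matrix_mult:
  "switched_matrix l *v v = l *\<^sub>R (A1 *v v) + (1 - l) *\<^sub>R (A0 *v v)"
  by (simp add: switched_matrix_def matrix_vector_mult_add_rdistrib scaleR_matrix_vector_assoc)

lemma norm_switched_matrix_mult_le:
  assumes "0 \<le> l" "l \<le> 1"
  shows "norm (switched_matrix l *v v) \<le> (onorm ((*v) A0) + onorm ((*v) A1)) * norm v"
proof -
  have "norm (switched_matrix l *v v) \<le> l * norm (A1 *v v) + (1 - l) * norm (A0 *v v)"
    unfolding switched_matrix_mult using assms by (intro order_trans[OF norm_triangle_ineq]) simp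
  also have "\<dots> \<le> norm (A1 *v v) + norm (A0 *v v)"
    using assms by (intro add_mono mult_left_le_one_le) auto
  also have "\<dots> \<le> onorm ((*v) A1) * norm v + onorm ((*v) A0) * norm v"
    by (intro add_mono onorm matrix_vector_mul_bounded_linear)
  finally show ?thesis
    by (simp add: algebra_simps)
qed

lemma g_lipschitz_on_cball:
  assumes "norm v \<le> r" "norm w \<le> r"
  shows "norm (g v u - g w u) \<le> (onorm ((*v) A0) + onorm ((*v) A1)) * (1 + 3 * r\<^sup>2) * norm (v - w)"
proof -
  define \<beta> where "\<beta> = onorm ((*v) A0) + onorm ((*v) A1)"
  define B where "B = switched_matrix (sat u)"
  have B: "norm (B *v z) \<le> \<beta> * norm z" for z
    unfolding B_def \<beta>_def by (intro norm_switched_matrix_mult_le sat_bounds)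
  have "0 \<le> r"
    using assms norm_ge_zero order_trans by blast
  have split: "g v u - g w u = (1 + (norm v)\<^sup>2) *\<^sub>R (B *v (v - w)) + ((norm v)\<^sup>2 - (norm w)\<^sup>2) *\<^sub>R (B *v w)"
    by (simp add: g_switched_matrix B_def matrix_vector_right_distrib algebra_simps)
  have first: "norm ((1 + (norm v)\<^sup>2) *\<^sub>R (B *v (v - w))) \<le> (1 + r\<^sup>2) * (\<beta> * norm (v - w))"
    using assms B[of "v - w"] by (simp, intro mult_mono add_left_mono power_mono) auto
  have "\<bar>(norm v)\<^sup>2 - (norm w)\<^sup>2\<bar> \<le> 2 * r * norm (v - w)"
  proof -
    have "(norm v)\<^sup>2 - (norm w)\<^sup>2 = (norm v - norm w) * (norm v + norm w)"
      by (simp add: power2_eq_square algebra_simps)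
    then have "\<bar>(norm v)\<^sup>2 - (norm w)\<^sup>2\<bar> = \<bar>norm v - norm w\<bar> * (norm v + norm w)"
      by (simp add: abs_mult)
    also have "\<dots> \<le> norm (v - w) * (2 * r)"
      using assms by (intro mult_mono norm_triangle_ineq3) auto
    finally show ?thesis
      by (simp add: algebra_simps)
  qed
  then have second: "norm (((norm v)\<^sup>2 - (norm w)\<^sup>2) *\<^sub>R (B *v w)) \<le> (2 * r * norm (v - w)) * (\<beta> * r)"
    using B[of w] assms \<open>0 \<le> r\<close>
    by (simp, intro mult_mono order_trans[OF B[of w]] mult_left_mono) (auto simp: \<beta>_def onorm_pos_le)
  have "norm (g v u - g w u) \<le> (1 + r\<^sup>2) * (\<beta> * norm (v - w)) + (2 * r * norm (v - w)) * (\<beta> * r)"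
    unfolding split using norm_triangle_ineq first second by (rule order_trans[OF _ add_mono])
  then show ?thesis
    by (simp add: \<beta>_def algebra_simps power2_eq_square)
qed

lemma g_ode_unique:
  fixes x y :: "real \<Rightarrow> real^2"
  assumes dx: "\<And>t. t \<in> {0..1} \<Longrightarrow> (x has_vector_derivative c *\<^sub>R g (x t) (u t)) (at t within {0..1})"
    and dy: "\<And>t. t \<in> {0..1} \<Longrightarrow> (y has_vector_derivative c *\<^sub>R g (y t) (u t)) (at t within {0..1})"
    and "x 0 = y 0"
  shows "x 1 = y 1"
proof -
  have "continuous_on {0..1} x" "continuous_on {0..1} y"
    unfolding continuous_on_eq_continuous_within
    using dx dy by (blast intro: has_vector_derivative_continuous)+
  then have "bounded (x ` {0..1} \<union> y ` {0..1})"
    by (intro compact_imp_bounded compact_Un compact_continuous_image) auto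
  then obtain r where r: "\<And>z. z \<in> x ` {0..1} \<union> y ` {0..1} \<Longrightarrow> norm z \<le> r"
    unfolding bounded_iff by blast
  let ?L = "\<bar>c\<bar> * ((onorm ((*v) A0) + onorm ((*v) A1)) * (1 + 3 * r\<^sup>2))"
  show ?thesis
  proof (rule lipschitz_ode_unique[where f = "\<lambda>t v. c *\<^sub>R g v (u t)" and L = ?L])
    fix t :: real assume t: "t \<in> {0..1}"
    have "norm (g (x t) (u t) - g (y t) (u t))
        \<le> (onorm ((*v) A0) + onorm ((*v) A1)) * (1 + 3 * r\<^sup>2) * norm (x t - y t)"
      using t r by (intro g_lipschitz_on_cball) auto
    then show "norm (c *\<^sub>R g (x t) (u t) - c *\<^sub>R g (y t) (u t)) \<le> ?L * norm (x t - y t)"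
      by (simp add: mult.assoc mult_left_mono flip: scaleR_diff_right)
  qed (use dx dy \<open>x 0 = y 0\<close> in auto)
qed

definition rot_dir :: "real \<Rightarrow> real^2" where
  "rot_dir p = vector [cos p, - sin p]"

definition rot_dir' :: "real \<Rightarrow> real^2" where
  "rot_dir' p = vector [- sin p, - cos p]"

lemma inner_rot_dir: "v \<bullet> rot_dir p = v$1 * cos p - v$2 * sin p"
  and inner_rot_dir': "v \<bullet> rot_dir' p = - v$1 * sin p - v$2 * cos p"
  by (simp_all add: inner_vec_def sum_2 rot_dir_def rot_dir'_def)

lemma rot_frame_expansion:
  "v = (v \<bullet> rot_dir p) *\<^sub>R rot_dir p + (v \<bullet> rot_dir' p) *\<^sub>R rot_dir' p"
proof -
  have unit: "(sin p)\<^sup>2 + (cos p)\<^sup>2 = 1"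
    by simp
  have "v$1 = (v$1 * cos p - v$2 * sin p) * cos p + (- v$1 * sin p - v$2 * cos p) * (- sin p)"
    using unit by algebra
  moreover have "v$2 = (v$1 * cos p - v$2 * sin p) * (- sin p) + (- v$1 * sin p - v$2 * cos p) * (- cos p)"
    using unit by algebra
  ultimately show ?thesis
    unfolding vec_eq_iff forall_2 inner_rot_dir inner_rot_dir' by (simp add: rot_dir_def rot_dir'_def)
qed

lemma norm_rot_dir [simp]: "norm (rot_dir p) = 1"
  by (simp add: norm_eq_sqrt_inner inner_rot_dir) (simp add: rot_dir_def power2_eq_square[symmetric])

lemma has_vector_derivative_rot_dir: "(rot_dir has_vector_derivative rot_dir' p) (at p)"
proof -
  have rot_dir_eq: "rot_dir = (\<lambda>p. cos p *\<^sub>R vector [1, 0] + sin p *\<^sub>R vector [0, -1])"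
    by (simp add: fun_eq_iff vec_eq_iff forall_2 rot_dir_def)
  have rot_dir'_eq: "rot_dir' p = (- sin p) *\<^sub>R vector [1, 0] + cos p *\<^sub>R vector [0, -1]"
    by (simp add: vec_eq_iff forall_2 rot_dir'_def)
  show ?thesis
    unfolding rot_dir_eq rot_dir'_eq by (auto intro!: derivative_eq_intros)
qed

definition radial_rate :: "real \<Rightarrow> real \<Rightarrow> real" where
  "radial_rate p l = (switched_matrix l *v rot_dir p) \<bullet> rot_dir p"

definition angular_rate :: "real \<Rightarrow> real \<Rightarrow> real" where
  "angular_rate p l = (switched_matrix l *v rot_dir p) \<bullet> rot_dir' p"

lemma switched_matrix_rot_dir:
  "switched_matrix l *v rot_dir p = radial_rate p l *\<^sub>R rot_dir p + angular_rate p l *\<^sub>R rot_dir' p"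
  unfolding radial_rate_def angular_rate_def by (rule rot_frame_expansion)

lemma radial_rate_affine: "radial_rate p l = (1 - l) * radial_rate p 0 + l * radial_rate p 1"
  and angular_rate_affine: "angular_rate p l = (1 - l) * angular_rate p 0 + l * angular_rate p 1"
  by (simp_all add: radial_rate_def angular_rate_def switched_matrix_mult inner_add_left)

lemma A0_rot_dir: "A0 *v rot_dir p = vector [- 1/10 * cos p - 1/2 * sin p, - 2 * cos p]"
  and A1_rot_dir: "A1 *v rot_dir p = vector [- 2 * sin p, - 1/2 * cos p + 1/10 * sin p]"
  by (simp_all add: vec_eq_iff forall_2 A0_def A1_def rot_dir_def matrix_vector_mult_def sum_2)

lemma radial_rate_0: "radial_rate p 0 = 3/2 * cos p * sin p - 1/10 * (cos p)\<^sup>2"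
  and radial_rate_1: "radial_rate p 1 = - 3/2 * cos p * sin p - 1/10 * (sin p)\<^sup>2"
  and angular_rate_0: "angular_rate p 0 = 2 * (cos p)\<^sup>2 + 1/2 * (sin p)\<^sup>2 + 1/10 * cos p * sin p"
  and angular_rate_1: "angular_rate p 1 = 1/2 * (cos p)\<^sup>2 + 2 * (sin p)\<^sup>2 - 1/10 * cos p * sin p"
  by (simp_all add: radial_rate_def angular_rate_def switched_matrix_def inner_rot_dir inner_rot_dir'
      A0_rot_dir A1_rot_dir power2_eq_square algebra_simps)

lemma radial_rate_eq:
    "radial_rate p l = (1 - l) * (3/2 * cos p * sin p - 1/10 * (cos p)\<^sup>2)
      + l * (- 3/2 * cos p * sin p - 1/10 * (sin p)\<^sup>2)"
  and angular_rate_eq: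
    "angular_rate p l = (1 - l) * (2 * (cos p)\<^sup>2 + 1/2 * (sin p)\<^sup>2 + 1/10 * cos p * sin p)
      + l * (1/2 * (cos p)\<^sup>2 + 2 * (sin p)\<^sup>2 - 1/10 * cos p * sin p)"
  by (subst radial_rate_affine angular_rate_affine,
      simp only: radial_rate_0 radial_rate_1 angular_rate_0 angular_rate_1)+

lemma angular_rate_bounds:
  assumes "0 \<le> l" "l \<le> 1"
  shows "2/5 \<le> angular_rate p l" "angular_rate p l \<le> 21/10"
proof -
  have unit: "(cos p)\<^sup>2 + (sin p)\<^sup>2 = 1"
    by simp
  have "0 \<le> 8/5 * (cos p)\<^sup>2 + 1/10 * cos p * sin p + 1/10 * (sin p)\<^sup>2"
    "0 \<le> 1/10 * (cos p)\<^sup>2 + (- 1/10) * cos p * sin p + 8/5 * (sin p)\<^sup>2"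
    by (rule quadratic_form_nonneg; simp add: power2_eq_square)+
  then have "2/5 \<le> angular_rate p 0" "2/5 \<le> angular_rate p 1"
    "angular_rate p 0 \<le> 21/10" "angular_rate p 1 \<le> 21/10"
    unfolding angular_rate_0 angular_rate_1 using unit by linarith+
  then show "2/5 \<le> angular_rate p l" "angular_rate p l \<le> 21/10"
    using assms by (subst angular_rate_affine; intro convex_bound_ge convex_bound_le; simp)+
qed

definition switch_law :: "real \<Rightarrow> real" where
  "switch_law p = sat (1/2 - 100 * sin (2 * p))"

lemma switch_law_bounds: "0 \<le> switch_law p" "switch_law p \<le> 1"
  by (simp_all add: switch_law_def sat_bounds)

lemma continuous_on_switch_law [continuous_intros]:
  fixes f :: "'a::t2_space \<Rightarrow> real"
  assumes "continuous_on S f"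
  shows "continuous_on S (\<lambda>x. switch_law (f x))"
  unfolding switch_law_def by (intro continuous_intros assms)

lemma switch_law_shift: "switch_law (p + pi/2) = 1 - switch_law p"
proof -
  have "sin (2 * (p + pi/2)) = - sin (2 * p)"
    by (simp add: distrib_left sin_periodic_pi)
  then show ?thesis
    unfolding switch_law_def using sat_one_minus[of "1/2 - 100 * sin (2 * p)"] by simp
qed

lemma switch_law_eq_0:
  assumes "1/100 \<le> p" "p \<le> pi/2 - 1/100"
  shows "switch_law p = 0"
proof -
  have "1/100 \<le> sin (1/50 :: real)"
    using sin_ge_half_self[of "1/50"] pi_gt3 by simp
  also have "sin (1/50) \<le> sin (2 * p)"
  proof (cases "p \<le> pi/4")
    case True
    then show ?thesis
      using assms pi_gt3 by (intro sin_monotone_2pi_le) auto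
  next
    case False
    then have "sin (1/50) \<le> sin (pi - 2 * p)"
      using assms pi_gt3 by (intro sin_monotone_2pi_le) auto
    then show ?thesis
      by simp
  qed
  finally show ?thesis
    by (simp add: switch_law_def sat_def)
qed

text \<open>\<open>A1\<close> is \<open>A0\<close> conjugated by the rotation through \<open>pi/2\<close>, and the switching law is
  equivariant under it, so the dynamics in polar coordinates is \<open>pi/2\<close>-periodic in the angle.\<close>

lemma radial_rate_shift: "radial_rate (p + pi/2) l = radial_rate p (1 - l)"
  and angular_rate_shift: "angular_rate (p + pi/2) l = angular_rate p (1 - l)"
  by (simp_all add: radial_rate_eq angular_rate_eq sin_add cos_add algebra_simps)

section \<open>Linear growth of the log-radius\<close>

definition log_slope :: "real \<Rightarrow> real" where
  "log_slope p = radial_rate p (switch_law p) / angular_rate p (switch_law p)"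

lemma angular_rate_switch_law_bounds:
  "2/5 \<le> angular_rate p (switch_law p)" "angular_rate p (switch_law p) \<le> 21/10"
  using angular_rate_bounds switch_law_bounds by blast+

lemma log_slope_shift: "log_slope (p + pi/2) = log_slope p"
  by (simp add: log_slope_def switch_law_shift radial_rate_shift angular_rate_shift)

lemma continuous_on_log_slope [continuous_intros]: "continuous_on S log_slope"
proof -
  have "continuous_on S (\<lambda>p. radial_rate p (switch_law p))"
    "continuous_on S (\<lambda>p. angular_rate p (switch_law p))"
    unfolding radial_rate_eq angular_rate_eq by (intro continuous_intros)+
  moreover have "angular_rate p (switch_law p) \<noteq> 0" for p
    using angular_rate_switch_law_bounds(1)[of p] by linarith
  ultimately show ?thesis
    unfolding log_slope_def[abs_def] by (intro continuous_intros) auto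
qed

lemma log_slope_ge:
  assumes "m * angular_rate p (switch_law p) \<le> radial_rate p (switch_law p)"
  shows "m \<le> log_slope p"
  using assms angular_rate_switch_law_bounds(1)[of p] by (simp add: log_slope_def pos_le_divide_eq)

lemma log_slope_ge_minus_one: "-1 \<le> log_slope p"
proof (rule log_slope_ge)
  let ?l = "switch_law p"
  have "0 \<le> 19/10 * (cos p)\<^sup>2 + 8/5 * cos p * sin p + 1/2 * (sin p)\<^sup>2"
    "0 \<le> 1/2 * (cos p)\<^sup>2 + (- 8/5) * cos p * sin p + 19/10 * (sin p)\<^sup>2"
    by (rule quadratic_form_nonneg; simp add: power2_eq_square)+
  then have "0 \<le> radial_rate p 0 + angular_rate p 0" "0 \<le> radial_rate p 1 + angular_rate p 1"
    by (simp_all add: radial_rate_0 radial_rate_1 angular_rate_0 angular_rate_1)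
  then have "0 \<le> (1 - ?l) * (radial_rate p 0 + angular_rate p 0) + ?l * (radial_rate p 1 + angular_rate p 1)"
    using switch_law_bounds[of p] by (intro convex_bound_ge) auto
  then show "-1 * angular_rate p ?l \<le> radial_rate p ?l"
    by (subst radial_rate_affine, subst angular_rate_affine) (simp add: algebra_simps)
qed

lemma log_slope_ge_on_first_quadrant:
  assumes "1/100 \<le> p" "p \<le> pi/2 - 1/100"
  shows "-1/20 \<le> log_slope p"
proof (rule log_slope_ge)
  have "0 \<le> cos p" "0 \<le> sin p"
    using assms pi_gt3 by (auto intro!: cos_ge_zero sin_ge_zero)
  then have "0 \<le> 301/200 * (cos p * sin p) + 1/40 * (sin p)\<^sup>2"
    by simp
  then show "-1/20 * angular_rate p (switch_law p) \<le> radial_rate p (switch_law p)"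
    using switch_law_eq_0[OF assms]
    by (simp add: radial_rate_0 angular_rate_0 algebra_simps power2_eq_square)
qed

lemma log_slope_ge_near_diagonal:
  assumes "pi/6 \<le> p" "p \<le> pi/3"
  shows "3/10 \<le> log_slope p"
proof (rule log_slope_ge)
  let ?c = "cos p" and ?s = "sin p"
  have "1/2 \<le> ?s"
    using sin_monotone_2pi_le[of "pi/6" p] assms pi_gt3 by (simp add: sin_30)
  moreover have "1/2 \<le> ?c"
    using cos_monotone_0_pi_le[of p "pi/3"] assms pi_gt3 by (simp add: cos_60)
  moreover have "?s \<le> 1"
    by simp
  moreover have "?c \<le> 9/10"
  proof (rule power2_le_imp_le)
    have "(1/2)\<^sup>2 \<le> ?s\<^sup>2"
      using \<open>1/2 \<le> ?s\<close> by (intro power_mono) auto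
    then show "?c\<^sup>2 \<le> (9/10)\<^sup>2"
      unfolding cos_squared_eq by (simp add: power2_eq_square)
  qed simp
  \<comment> \<open>\<open>radial_rate p 0 - 3/10 * angular_rate p 0\<close> is a quadratic form in \<open>(cos p, sin p)\<close>,
    positive when \<open>0.51 < tan p < 9\<close>.\<close>
  ultimately have "0 \<le> 3/20 * ((?s - 51/100 * ?c) * (9 * ?c - ?s)) + ?c * (87/2000 * ?s - 23/2000 * ?c)"
    by (intro add_nonneg_nonneg mult_nonneg_nonneg; linarith)
  also have "\<dots> = radial_rate p 0 - 3/10 * angular_rate p 0"
    by (simp add: radial_rate_0 angular_rate_0 power2_eq_square field_simps)
  finally show "3/10 * angular_rate p (switch_law p) \<le> radial_rate p (switch_law p)"
    using switch_law_eq_0[of p] assms pi_gt3 by simp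
qed

text \<open>The lower limit \<open>-1\<close> makes \<open>log_radius\<close> differentiable at every \<open>p \<ge> 0\<close>.\<close>

definition log_radius :: "real \<Rightarrow> real" where
  "log_radius p = integral {-1..p} log_slope"

lemma log_radius_has_derivative:
  assumes "-1 < p"
  shows "(log_radius has_real_derivative log_slope p) (at p)"
proof -
  have "(log_radius has_real_derivative log_slope p) (at p within {-1..p+1})"
    unfolding log_radius_def[abs_def] using assms
    by (intro integral_has_real_derivative continuous_on_log_slope) auto
  moreover have "at p within {-1..p+1} = at p"
    using assms by (intro at_within_Icc_at) auto
  ultimately show ?thesis
    by simp
qed

lemma isCont_log_radius: "-1 < p \<Longrightarrow> isCont log_radius p"
  using log_radius_has_derivative by (rule DERIV_isCont)

lemma log_radius_increment_ge:
  assumes "0 \<le> a" "a \<le> b" "\<And>p. a \<le> p \<Longrightarrow> p \<le> b \<Longrightarrow> m \<le> log_slope p"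
  shows "m * (b - a) \<le> log_radius b - log_radius a"
  using assms by (intro DERIV_ge_imp_increment_ge[of a b log_radius log_slope])
    (auto intro!: log_radius_has_derivative)

lemma log_radius_quarter_turn_gain: "0 < log_radius (pi/2) - log_radius 0"
proof -
  define d :: real where "d = 1/100"
  have "-1 * (d - 0) \<le> log_radius d - log_radius 0"
    using log_slope_ge_minus_one by (intro log_radius_increment_ge) (auto simp: d_def)
  moreover have "-1/20 * (pi/6 - d) \<le> log_radius (pi/6) - log_radius d"
    using pi_gt3 by (intro log_radius_increment_ge log_slope_ge_on_first_quadrant) (auto simp: d_def)
  moreover have "3/10 * (pi/3 - pi/6) \<le> log_radius (pi/3) - log_radius (pi/6)"
    using pi_gt3 by (intro log_radius_increment_ge log_slope_ge_near_diagonal) auto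
  moreover have "-1/20 * (pi/2 - d - pi/3) \<le> log_radius (pi/2 - d) - log_radius (pi/3)"
    using pi_gt3 by (intro log_radius_increment_ge log_slope_ge_on_first_quadrant) (auto simp: d_def)
  moreover have "-1 * (pi/2 - (pi/2 - d)) \<le> log_radius (pi/2) - log_radius (pi/2 - d)"
    using pi_gt3 log_slope_ge_minus_one by (intro log_radius_increment_ge) (auto simp: d_def)
  ultimately show ?thesis
    using pi_gt3 by (simp add: d_def algebra_simps)
qed

lemma log_radius_linear_growth:
  obtains \<gamma> K where "0 < \<gamma>" "\<And>p. 0 \<le> p \<Longrightarrow> \<bar>log_radius p - log_radius 0 - \<gamma> * p\<bar> \<le> K"
proof -
  obtain K where "\<And>p. 0 \<le> p \<Longrightarrow>
      \<bar>log_radius p - log_radius 0 - (log_radius (pi/2) - log_radius 0) / (pi/2) * p\<bar> \<le> K"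
    by (rule periodic_derivative_linear_growth[of log_radius log_slope "pi/2"])
      (auto intro: log_radius_has_derivative log_slope_shift)
  moreover have "0 < (log_radius (pi/2) - log_radius 0) / (pi/2)"
    using log_radius_quarter_turn_gain by simp
  ultimately show ?thesis
    using that by blast
qed

lemma exists_angle_with_large_radius:
  obtains p where "a \<le> p" "r \<le> log_radius p" "switch_law p = 0"
proof -
  obtain \<gamma> K where \<gamma>: "0 < \<gamma>"
    and K: "\<And>p. 0 \<le> p \<Longrightarrow> \<bar>log_radius p - log_radius 0 - \<gamma> * p\<bar> \<le> K"
    using log_radius_linear_growth by blast
  obtain k :: nat where k: "max 0 (max a ((r - log_radius 0 + K) / \<gamma>)) / pi \<le> real k"
    using real_arch_simple by blast
  define p where "p = real k * pi + pi/4"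
  have "max 0 (max a ((r - log_radius 0 + K) / \<gamma>)) \<le> real k * pi"
    using k by (simp only: pos_divide_le_eq[OF pi_gt_zero])
  also have "\<dots> \<le> p"
    using pi_gt_zero by (simp add: p_def)
  finally have "0 \<le> p" "a \<le> p" "(r - log_radius 0 + K) / \<gamma> \<le> p"
    by auto
  moreover from this(3) have "r \<le> log_radius p"
    using K[OF \<open>0 \<le> p\<close>] \<gamma> by (simp add: divide_le_eq abs_le_iff mult.commute)
  moreover have "sin (2 * p) = 1"
  proof -
    have "2 * p = pi/2 + real (2 * k) * pi"
      by (simp add: p_def algebra_simps)
    then show ?thesis
      by (simp add: sin_add)
  qed
  then have "switch_law p = 0"
    by (simp add: switch_law_def sat_def)
  ultimately show thesis
    using that by blast
qed

section \<open>Time along the spiral\<close>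

definition spiral :: "real \<Rightarrow> real \<Rightarrow> real^2" where
  "spiral R p = exp (log_radius p - R) *\<^sub>R rot_dir p"

definition angular_speed :: "real \<Rightarrow> real \<Rightarrow> real \<Rightarrow> real" where
  "angular_speed c R p = c * (1 + exp (2 * (log_radius p - R))) * angular_rate p (switch_law p)"

lemma norm_spiral: "norm (spiral R p) = exp (log_radius p - R)"
  by (simp add: spiral_def)

lemma angular_speed_pos: "0 < c \<Longrightarrow> 0 < angular_speed c R p"
  using angular_rate_switch_law_bounds(1)[of p] unfolding angular_speed_def
  by (intro mult_pos_pos add_pos_pos) auto

lemma spiral_has_vector_derivative:
  assumes "-1 < p" "0 < c"
  shows "(spiral R has_vector_derivative
           inverse (angular_speed c R p) *\<^sub>R (c *\<^sub>R g (spiral R p) (switch_law p))) (at p)"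
proof -
  let ?r = "exp (log_radius p - R)" and ?l = "switch_law p"
  let ?v = "(?r * log_slope p) *\<^sub>R rot_dir p + ?r *\<^sub>R rot_dir' p"
  have deriv: "(spiral R has_vector_derivative ?v) (at p)"
    unfolding spiral_def[abs_def]
    using log_radius_has_derivative[OF assms(1)] has_vector_derivative_rot_dir
    by (auto intro!: derivative_eq_intros simp: has_real_derivative_iff_has_vector_derivative)
  have tangent: "angular_speed c R p *\<^sub>R ?v = c *\<^sub>R g (spiral R p) ?l"
  proof -
    have "radial_rate p ?l = angular_rate p ?l * log_slope p"
      using angular_rate_switch_law_bounds(1)[of p] by (simp add: log_slope_def)
    moreover have "(norm (spiral R p))\<^sup>2 = exp (2 * (log_radius p - R))"
      by (simp add: norm_spiral flip: exp_double)
    ultimately show ?thesis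
      using switch_law_bounds[of p]
      by (simp add: angular_speed_def g_switched_matrix sat_eq_self spiral_def
          matrix_vector_mult_scaleR switched_matrix_rot_dir algebra_simps)
  qed
  have "angular_speed c R p \<noteq> 0"
    using angular_speed_pos[OF assms(2)] by (simp add: less_le)
  then show ?thesis
    using deriv by (simp flip: tangent)
qed

definition time_to_angle :: "real \<Rightarrow> real \<Rightarrow> real \<Rightarrow> real" where
  "time_to_angle c R p = integral {0..p} (\<lambda>q. inverse (angular_speed c R q))"

lemma time_to_angle_has_derivative:
  assumes "0 < c" "0 < p"
  shows "(time_to_angle c R has_real_derivative inverse (angular_speed c R p)) (at p)"
proof -
  have "continuous_on {0..p+1} log_radius"
    by (intro continuous_at_imp_continuous_on ballI isCont_log_radius) auto
  then have "continuous_on {0..p+1} (angular_speed c R)"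
    unfolding angular_speed_def angular_rate_eq by (intro continuous_intros)
  then have "continuous_on {0..p+1} (\<lambda>q. inverse (angular_speed c R q))"
    using angular_speed_pos[OF assms(1)] by (intro continuous_intros) (auto simp: less_le)
  then have "(time_to_angle c R has_real_derivative inverse (angular_speed c R p)) (at p within {0..p+1})"
    unfolding time_to_angle_def[abs_def] using assms by (intro integral_has_real_derivative) auto
  moreover have "at p within {0..p+1} = at p"
    using assms by (intro at_within_Icc_at) auto
  ultimately show ?thesis
    by simp
qed

lemma isCont_time_to_angle: "0 < c \<Longrightarrow> 0 < p \<Longrightarrow> isCont (time_to_angle c R) p"
  by (rule DERIV_isCont[OF time_to_angle_has_derivative])

lemma time_to_angle_mono:
  assumes "0 < c" "0 < a" "a \<le> b"
  shows "time_to_angle c R a \<le> time_to_angle c R b"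
proof -
  have "0 * (b - a) \<le> time_to_angle c R b - time_to_angle c R a"
    using assms angular_speed_pos[OF assms(1)]
    by (intro DERIV_ge_imp_increment_ge[where f = "time_to_angle c R"
          and f' = "\<lambda>p. inverse (angular_speed c R p)"] time_to_angle_has_derivative)
      (auto intro: less_imp_le)
  then show ?thesis
    by simp
qed

lemma time_to_angle_increment_ge:
  assumes "0 < c" "0 < a" "a \<le> b" "\<And>p. a \<le> p \<Longrightarrow> p \<le> b \<Longrightarrow> log_radius p \<le> R"
  shows "(b - a) / (21/5 * c) \<le> time_to_angle c R b - time_to_angle c R a"
proof -
  have "inverse (21/5 * c) * (b - a) \<le> time_to_angle c R b - time_to_angle c R a"
  proof (rule DERIV_ge_imp_increment_ge[where f = "time_to_angle c R", OF \<open>a \<le> b\<close>])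
    fix p assume p: "a \<le> p" "p \<le> b"
    show "(time_to_angle c R has_real_derivative inverse (angular_speed c R p)) (at p)"
      using p assms by (intro time_to_angle_has_derivative) auto
    have "exp (2 * (log_radius p - R)) \<le> 1"
      using assms(4)[OF p] by simp
    then have "angular_speed c R p \<le> c * 2 * (21/10)"
      using assms(1) angular_rate_switch_law_bounds[of p] unfolding angular_speed_def
      by (intro mult_mono) auto
    then show "inverse (21/5 * c) \<le> inverse (angular_speed c R p)"
      using angular_speed_pos[OF assms(1)] by (intro le_imp_inverse_le) auto
  qed
  then show ?thesis
    by (simp add: field_simps)
qed

lemma time_to_angle_tail_le:
  assumes "0 < c" "0 < \<alpha>" "0 < a" "a \<le> b"
    and growth: "\<And>p. a \<le> p \<Longrightarrow> \<alpha> * (p - a) - \<beta> \<le> log_radius p - R"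
  shows "time_to_angle c R b - time_to_angle c R a \<le> 5 * exp (2 * \<beta>) / (4 * c * \<alpha>)"
proof -
  have "time_to_angle c R b - time_to_angle c R a \<le> (5 * exp (2 * \<beta>) / (2 * c)) / (2 * \<alpha>)"
  proof (rule DERIV_le_exp_decay_imp_increment_le[where f = "time_to_angle c R" and a = a and b = b])
    fix p assume p: "a \<le> p" "p \<le> b"
    show "(time_to_angle c R has_real_derivative inverse (angular_speed c R p)) (at p)"
      using p assms by (intro time_to_angle_has_derivative) auto
    have "exp (2 * (\<alpha> * (p - a) - \<beta>)) \<le> 1 + exp (2 * (log_radius p - R))"
      using growth[OF p(1)] by (smt (verit) exp_gt_zero exp_le_cancel_iff)
    then have "c * exp (2 * (\<alpha> * (p - a) - \<beta>)) * (2/5) \<le> angular_speed c R p"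
      using assms(1) angular_rate_switch_law_bounds[of p] unfolding angular_speed_def
      by (intro mult_mono) auto
    then have "inverse (angular_speed c R p) \<le> inverse (c * exp (2 * (\<alpha> * (p - a) - \<beta>)) * (2/5))"
      using assms(1) by (intro le_imp_inverse_le) auto
    also have "\<dots> = 5 * exp (2 * \<beta>) / (2 * c) * exp (- (2 * \<alpha>) * (p - a))"
    proof -
      define X Y where "X = exp (2 * \<alpha> * (p - a))" and "Y = exp (2 * \<beta>)"
      have e1: "exp (2 * (\<alpha> * (p - a) - \<beta>)) = X / Y"
        unfolding X_def Y_def by (simp add: algebra_simps flip: exp_diff)
      have e2: "exp (- (2 * \<alpha>) * (p - a)) = inverse X"
        unfolding X_def by (simp flip: exp_minus)
      have "0 < X" "0 < Y"
        unfolding X_def Y_def by simp_all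
      then show ?thesis
        unfolding e1 e2 Y_def[symmetric] by (simp add: field_simps)
    qed
    finally show "inverse (angular_speed c R p) \<le> 5 * exp (2 * \<beta>) / (2 * c) * exp (- (2 * \<alpha>) * (p - a))" .
  qed (use assms in auto)
  then show ?thesis
    by (simp add: field_simps)
qed

lemma spiral_time_budget:
  obtains c b R where "0 < c" "1 \<le> b" "\<And>p. 0 \<le> p \<Longrightarrow> p \<le> b \<Longrightarrow> log_radius p \<le> R"
    "1 \<le> time_to_angle c R b - time_to_angle c R 1"
    "\<And>q. b \<le> q \<Longrightarrow> time_to_angle c R q - time_to_angle c R b \<le> 1/2"
proof -
  obtain \<gamma> K where \<gamma>: "0 < \<gamma>"
    and K: "\<And>p. 0 \<le> p \<Longrightarrow> \<bar>log_radius p - log_radius 0 - \<gamma> * p\<bar> \<le> K"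
    using log_radius_linear_growth by blast
  \<comment> \<open>\<open>c\<close> bounds the time spent beyond angle \<open>b\<close> by \<open>1/2\<close>, \<open>b\<close> makes the turn from \<open>1\<close> to \<open>b\<close>
    last at least \<open>1\<close>, and \<open>R\<close> keeps the spiral in the unit disc up to angle \<open>b\<close>.\<close>
  define c where "c = 1 + 5 * exp (4 * K) / (2 * \<gamma>)"
  define b where "b = 21/5 * c + 1"
  define R where "R = log_radius 0 + K + \<gamma> * b"
  have c: "0 < c"
    unfolding c_def using \<gamma> by (intro add_pos_nonneg) auto
  have b: "1 \<le> b"
    using c by (simp add: b_def)
  have below: "log_radius p \<le> R" if "0 \<le> p" "p \<le> b" for p
  proof -
    have "\<gamma> * p \<le> \<gamma> * b"
      using that \<gamma> by simp
    then show ?thesis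
      using K[OF that(1)] by (simp add: R_def abs_le_iff)
  qed
  have "(b - 1) / (21/5 * c) \<le> time_to_angle c R b - time_to_angle c R 1"
    using c b below by (intro time_to_angle_increment_ge) auto
  then have head: "1 \<le> time_to_angle c R b - time_to_angle c R 1"
    using c by (simp add: b_def)
  have tail: "time_to_angle c R q - time_to_angle c R b \<le> 1/2" if "b \<le> q" for q
  proof -
    have "time_to_angle c R q - time_to_angle c R b \<le> 5 * exp (2 * (2 * K)) / (4 * c * \<gamma>)"
    proof (rule time_to_angle_tail_le)
      show "\<gamma> * (p - b) - 2 * K \<le> log_radius p - R" if "b \<le> p" for p
        using K[of p] that b by (simp add: R_def abs_le_iff algebra_simps)
    qed (use c \<gamma> b that in auto)
    also have "\<dots> \<le> 1/2"
    proof (subst pos_divide_le_eq)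
      show "0 < 4 * c * \<gamma>"
        using c \<gamma> by simp
      show "5 * exp (2 * (2 * K)) \<le> 1/2 * (4 * c * \<gamma>)"
        unfolding c_def using \<gamma> by (simp add: field_simps)
    qed
    finally show ?thesis .
  qed
  show thesis
    using that c b below head tail by blast
qed

lemma spiral_along_time_change:
  assumes "0 < c" "-1 < \<theta> t" "(\<theta> has_real_derivative angular_speed c R (\<theta> t)) (at t)"
  shows "((\<lambda>t. spiral R (\<theta> t)) has_vector_derivative
           c *\<^sub>R g (spiral R (\<theta> t)) (switch_law (\<theta> t))) (at t)"
proof -
  have "((spiral R \<circ> \<theta>) has_vector_derivative angular_speed c R (\<theta> t) *\<^sub>R
      (inverse (angular_speed c R (\<theta> t)) *\<^sub>R (c *\<^sub>R g (spiral R (\<theta> t)) (switch_law (\<theta> t))))) (at t)"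
    using assms by (intro vector_diff_chain_at spiral_has_vector_derivative)
      (simp_all add: has_real_derivative_iff_has_vector_derivative)
  then show ?thesis
    using angular_speed_pos[OF assms(1), of R "\<theta> t"] by (simp add: o_def field_simps)
qed

lemma spiral_arc_of_unit_time:
  assumes c: "0 < c" and b: "1 \<le> b"
    and head: "1 \<le> time_to_angle c R b - time_to_angle c R 1"
    and tail: "\<And>q. b \<le> q \<Longrightarrow> time_to_angle c R q - time_to_angle c R b \<le> 1/2"
    and "b \<le> q"
  obtains \<theta> where "1 \<le> \<theta> 0" "\<theta> 0 \<le> b" "\<theta> 1 = q"
    "\<And>t. t \<in> {0..1} \<Longrightarrow> 1 \<le> \<theta> t \<and> (\<theta> has_real_derivative angular_speed c R (\<theta> t)) (at t)"
proof -
  let ?\<Phi> = "time_to_angle c R"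
  have "continuous_on {1..b} ?\<Phi>"
    using c by (intro continuous_at_imp_continuous_on ballI isCont_time_to_angle) auto
  then have "continuous_on {1..b} (\<lambda>p. ?\<Phi> q - ?\<Phi> p)"
    by (intro continuous_intros)
  moreover have "1 \<le> ?\<Phi> q - ?\<Phi> 1"
    using head time_to_angle_mono[OF c, of b q R] b \<open>b \<le> q\<close> by simp
  ultimately obtain p where p: "1 \<le> p" "p \<le> b" "?\<Phi> q - ?\<Phi> p = 1"
    using IVT2'[of "\<lambda>p. ?\<Phi> q - ?\<Phi> p" b 1 1] tail[OF \<open>b \<le> q\<close>] b by auto
  then obtain \<theta> where "\<theta> 0 = p" "\<theta> 1 = q"
    "\<And>t. 0 \<le> t \<Longrightarrow> t \<le> 1 \<Longrightarrow>
      p \<le> \<theta> t \<and> (\<theta> has_real_derivative inverse (inverse (angular_speed c R (\<theta> t)))) (at t)"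
    using inverse_reparametrization[of ?\<Phi> "\<lambda>p. inverse (angular_speed c R p)" p q]
      time_to_angle_has_derivative[OF c] angular_speed_pos[OF c] b \<open>b \<le> q\<close> by auto
  with p show thesis
    using that by force
qed

definition open_loop_escape :: "real \<Rightarrow> real \<Rightarrow> (real \<Rightarrow> real^2) \<Rightarrow> (real \<Rightarrow> real) \<Rightarrow> bool" where
  "open_loop_escape c r x u \<longleftrightarrow>
     continuous_on {0..1} u \<and> (\<forall>t\<in>{0..1}. \<bar>u t\<bar> \<le> 1) \<and> u 1 = 0 \<and>
     norm (x 0) \<le> 1 \<and> r \<le> norm (x 1) \<and>
     (\<forall>t\<in>{0..1}. (x has_vector_derivative c *\<^sub>R g (x t) (u t)) (at t))"

lemma open_loop_blow_up: "\<exists>c>0. \<forall>M>0. \<exists>x u. open_loop_escape c (2 * M) x u"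
proof -
  obtain c b R where c: "0 < c" and b: "1 \<le> b"
    and below: "\<And>p. 0 \<le> p \<Longrightarrow> p \<le> b \<Longrightarrow> log_radius p \<le> R"
    and head: "1 \<le> time_to_angle c R b - time_to_angle c R 1"
    and tail: "\<And>q. b \<le> q \<Longrightarrow> time_to_angle c R q - time_to_angle c R b \<le> 1/2"
    by (rule spiral_time_budget) blast
  have "\<exists>x u. open_loop_escape c (2 * M) x u" if "0 < M" for M
  proof -
    obtain q where q: "b \<le> q" "R + ln (2 * M) \<le> log_radius q" "switch_law q = 0"
      by (rule exists_angle_with_large_radius)
    obtain \<theta> where \<theta>0: "1 \<le> \<theta> 0" "\<theta> 0 \<le> b" and \<theta>1: "\<theta> 1 = q"
      and \<theta>: "\<And>t. t \<in> {0..1} \<Longrightarrow>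
        1 \<le> \<theta> t \<and> (\<theta> has_real_derivative angular_speed c R (\<theta> t)) (at t)"
      using spiral_arc_of_unit_time[OF c b head tail q(1)] by blast
    have "continuous_on {0..1} \<theta>"
      using \<theta> by (intro continuous_at_imp_continuous_on ballI) (auto intro: DERIV_isCont)
    moreover have "norm (spiral R (\<theta> 0)) \<le> 1"
      using below \<theta>0 by (simp add: norm_spiral)
    moreover have "exp (ln (2 * M)) \<le> exp (log_radius q - R)"
      using q(2) by simp
    then have "2 * M \<le> norm (spiral R (\<theta> 1))"
      using \<open>0 < M\<close> by (simp add: \<theta>1 norm_spiral)
    moreover have "((\<lambda>t. spiral R (\<theta> t)) has_vector_derivative
        c *\<^sub>R g (spiral R (\<theta> t)) (switch_law (\<theta> t))) (at t)" if "t \<in> {0..1}" for t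
      using \<theta>[OF that] c by (intro spiral_along_time_change) auto
    ultimately have "open_loop_escape c (2 * M) (\<lambda>t. spiral R (\<theta> t)) (\<lambda>t. switch_law (\<theta> t))"
      using switch_law_bounds q(3) \<theta>1 unfolding open_loop_escape_def
      by (auto intro!: continuous_intros)
    then show ?thesis
      by blast
  qed
  then show ?thesis
    using c by blast
qed

section \<open>The delay system\<close>

definition decay_extension :: "(real \<Rightarrow> real) \<Rightarrow> real \<Rightarrow> real" where
  "decay_extension z t = (if t \<le> 0 then z t else z 0 * exp (- t))"

lemma continuous_on_decay_extension:
  assumes "continuous_on {a..0} z"
  shows "continuous_on {a..b} (decay_extension z)"
  unfolding decay_extension_def[abs_def]
proof (rule continuous_on_cases_le[where h = "\<lambda>t. t" and a = 0])
  show "continuous_on {t \<in> {a..b}. t \<le> 0} z"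
    by (rule continuous_on_subset[OF assms]) auto
qed (auto intro!: continuous_intros)

lemma decay_extension_has_derivative:
  assumes "0 \<le> t"
  shows "(decay_extension z has_vector_derivative - decay_extension z t) (at t within {0..})"
proof -
  have eq: "z 0 * exp (- s) = decay_extension z s" if "0 \<le> s" for s
    using that by (auto simp: decay_extension_def)
  have "((\<lambda>s. z 0 * exp (- s)) has_vector_derivative - (z 0 * exp (- t))) (at t within {0..})"
    by (auto intro!: derivative_eq_intros simp flip: has_real_derivative_iff_has_vector_derivative)
  then have "((\<lambda>s. z 0 * exp (- s)) has_vector_derivative - decay_extension z t) (at t within {0..})"
    by (simp only: eq[OF assms])
  then show ?thesis
    by (rule has_vector_derivative_transform_within[OF _ zero_less_one]) (use assms eq in auto)
qed

lemma is_solution_reduced: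
  assumes "is_solution c x0 z10 z20 x z1 z2" "\<forall>t\<in>{-2..-1}. z20 t = 1" "t \<in> {0..1}"
  shows "(x has_vector_derivative c *\<^sub>R g (x t) (z10 (t - 1))) (at t within {0..1})"
proof -
  have "(x has_vector_derivative (c * sat (z2 (t - 2))) *\<^sub>R g (x t) (z1 (t - 1))
      + (c * (1 - sat (z2 (t - 2)))) *\<^sub>R (A0 *v x t)) (at t within {0..1})"
    using assms(1,3) unfolding is_solution_def by blast
  moreover have "z2 (t - 2) = 1" "z1 (t - 1) = z10 (t - 1)"
    using assms unfolding is_solution_def by auto
  ultimately show ?thesis
    by (simp add: sat_eq_self)
qed

lemma is_solutionI:
  assumes "continuous_on {-2..1} x" "\<And>t. t \<in> {-2..0} \<Longrightarrow> x t = x0 t"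
    and x_deriv: "\<And>t. t \<in> {0..1} \<Longrightarrow>
      (x has_vector_derivative c *\<^sub>R g (x t) (z10 (t - 1))) (at t within {0..1})"
    and "continuous_on {-2..0} z10" "continuous_on {-2..0} z20" "\<forall>t\<in>{-2..-1}. z20 t = 1"
  shows "is_solution c x0 z10 z20 x (decay_extension z10) (decay_extension z20)"
proof -
  have deriv: "(decay_extension z has_vector_derivative - decay_extension z t) (at t within {0..1})"
    if "t \<in> {0..1}" for z t
    using decay_extension_has_derivative[of t z] that by (auto intro: has_vector_derivative_within_subset)
  have init: "decay_extension z t = z t" if "t \<le> 0" for z t
    using that by (simp add: decay_extension_def)
  show ?thesis
    unfolding is_solution_def
  proof (intro conjI ballI)
    fix t :: real assume t: "t \<in> {0..1}"
    have "decay_extension z20 (t - 2) = 1" "decay_extension z10 (t - 1) = z10 (t - 1)"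
      using t assms(6) by (simp_all add: init)
    then show "(x has_vector_derivative
        (c * sat (decay_extension z20 (t - 2))) *\<^sub>R g (x t) (decay_extension z10 (t - 1))
        + (c * (1 - sat (decay_extension z20 (t - 2)))) *\<^sub>R (A0 *v x t)) (at t within {0..1})"
      using x_deriv[OF t] by (simp add: sat_eq_self)
  qed (use assms deriv init in \<open>auto simp: continuous_on_decay_extension\<close>)
qed

lemma delay_system_follows_open_loop:
  fixes x :: "real \<Rightarrow> real^2"
  assumes u: "continuous_on {0..1} u"
    and x: "\<And>t. t \<in> {0..1} \<Longrightarrow> (x has_vector_derivative c *\<^sub>R g (x t) (u t)) (at t)"
    and z20: "continuous_on {-2..0} z20" "\<forall>t\<in>{-2..-1}. z20 t = 1"
  shows "(\<exists>x' z1 z2. is_solution c (\<lambda>_. x 0) (\<lambda>s. u (max 0 (s + 1))) z20 x' z1 z2) \<and>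
    (\<forall>x' z1 z2. is_solution c (\<lambda>_. x 0) (\<lambda>s. u (max 0 (s + 1))) z20 x' z1 z2 \<longrightarrow> x' 1 = x 1)"
proof -
  let ?z10 = "\<lambda>s. u (max 0 (s + 1))"
  define xs where "xs t = x (max 0 t)" for t
  have "continuous_on {-2..0} ?z10"
    by (rule continuous_on_compose2[OF u]) (auto intro!: continuous_intros)
  have "continuous_on {0..1} x"
    using x by (intro continuous_at_imp_continuous_on ballI has_vector_derivative_continuous) blast
  then have "continuous_on {-2..1} xs"
    unfolding xs_def[abs_def] by (rule continuous_on_compose2) (auto intro!: continuous_intros)
  have xs_deriv: "(xs has_vector_derivative c *\<^sub>R g (xs t) (?z10 (t - 1))) (at t within {0..1})"
    if t: "t \<in> {0..1}" for t
  proof -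
    have "(x has_vector_derivative c *\<^sub>R g (xs t) (?z10 (t - 1))) (at t within {0..1})"
      using x[OF t] t by (simp add: xs_def has_vector_derivative_at_within)
    then show ?thesis
      by (rule has_vector_derivative_transform_within[OF _ zero_less_one t]) (auto simp: xs_def)
  qed
  have "is_solution c (\<lambda>_. x 0) ?z10 z20 xs (decay_extension ?z10) (decay_extension z20)"
    using \<open>continuous_on {-2..1} xs\<close> xs_deriv \<open>continuous_on {-2..0} ?z10\<close> z20
    by (intro is_solutionI) (auto simp: xs_def)
  moreover have "x' 1 = x 1" if sol: "is_solution c (\<lambda>_. x 0) ?z10 z20 x' z1 z2" for x' z1 z2
  proof -
    have "x' 1 = xs 1"
    proof (rule g_ode_unique[where u = u])
      show "(x' has_vector_derivative c *\<^sub>R g (x' t) (u t)) (at t within {0..1})" if "t \<in> {0..1}" for t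
        using is_solution_reduced[OF sol z20(2) that] that by simp
      show "(xs has_vector_derivative c *\<^sub>R g (xs t) (u t)) (at t within {0..1})" if "t \<in> {0..1}" for t
        using xs_deriv[OF that] that by simp
      show "x' 0 = xs 0"
        using sol by (simp add: is_solution_def xs_def)
    qed
    then show ?thesis
      by (simp add: xs_def)
  qed
  ultimately show ?thesis
    by blast
qed

lemma delay_initial_data_of_open_loop_escape:
  assumes "open_loop_escape c r x u"
  shows "\<exists>z10 x0. continuous_on {-2..0} z10 \<and> (\<forall>t\<in>{-2..0}. \<bar>z10 t\<bar> \<le> 1) \<and> z10 0 = 0 \<and>
    continuous_on {-2..0} x0 \<and> (\<forall>t\<in>{-2..0}. norm (x0 t) \<le> 1) \<and>
    (\<forall>z20. continuous_on {-2..0} z20 \<and> (\<forall>t\<in>{-2..-1}. z20 t = 1) \<longrightarrow>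
      (\<exists>x z1 z2. is_solution c x0 z10 z20 x z1 z2) \<and>
      (\<forall>x z1 z2. is_solution c x0 z10 z20 x z1 z2 \<longrightarrow> norm (x 1) \<ge> r))"
proof -
  have u: "continuous_on {0..1} u" "\<forall>t\<in>{0..1}. \<bar>u t\<bar> \<le> 1" "u 1 = 0"
    and x: "norm (x 0) \<le> 1" "r \<le> norm (x 1)"
      "\<forall>t\<in>{0..1}. (x has_vector_derivative c *\<^sub>R g (x t) (u t)) (at t)"
    using assms unfolding open_loop_escape_def by auto
  define z10 where "z10 s = u (max 0 (s + 1))" for s
  have "continuous_on {-2..0} z10"
    unfolding z10_def by (rule continuous_on_compose2[OF u(1)]) (auto intro!: continuous_intros)
  moreover have "(\<exists>x' z1 z2. is_solution c (\<lambda>_. x 0) z10 z20 x' z1 z2) \<and>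
      (\<forall>x' z1 z2. is_solution c (\<lambda>_. x 0) z10 z20 x' z1 z2 \<longrightarrow> r \<le> norm (x' 1))"
    if "continuous_on {-2..0} z20" "\<forall>t\<in>{-2..-1}. z20 t = 1" for z20
  proof -
    have "\<exists>x' z1 z2. is_solution c (\<lambda>_. x 0) z10 z20 x' z1 z2"
      and unique: "\<And>x' z1 z2. is_solution c (\<lambda>_. x 0) z10 z20 x' z1 z2 \<Longrightarrow> x' 1 = x 1"
      using delay_system_follows_open_loop[OF u(1) _ that, of x c] x(3)
      unfolding z10_def[abs_def] by blast+
    then show ?thesis
      using x(2) by (auto dest!: unique)
  qed
  ultimately show ?thesis
    using u x by (intro exI[of _ z10] exI[of _ "\<lambda>_. x 0"]) (auto simp: z10_def)
qed

theorem lemma1: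
  shows "\<exists>c>0. \<forall>M>0. \<exists>(z10 :: real \<Rightarrow> real) (x0 :: real \<Rightarrow> real^2).
           continuous_on {-2..0} z10 \<and> (\<forall>t\<in>{-2..0}. \<bar>z10 t\<bar> \<le> 1) \<and> z10 0 = 0 \<and>
           continuous_on {-2..0} x0 \<and> (\<forall>t\<in>{-2..0}. norm (x0 t) \<le> 1) \<and>
           (\<forall>z20 :: real \<Rightarrow> real. continuous_on {-2..0} z20 \<and> (\<forall>t\<in>{-2..-1}. z20 t = 1) \<longrightarrow>
              (\<exists>x z1 z2. is_solution c x0 z10 z20 x z1 z2) \<and>
              (\<forall>x z1 z2. is_solution c x0 z10 z20 x z1 z2 \<longrightarrow> norm (x 1) \<ge> 2 * M))"
proof -
  obtain c where "0 < c" and "\<And>M. 0 < M \<Longrightarrow> \<exists>x u. open_loop_escape c (2 * M) x u"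
    using open_loop_blow_up by blast
  then show ?thesis
    using delay_initial_data_of_open_loop_escape by blast
qed

end
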